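(* Let $X_1,\dots,X_m$ be a family of Hörmander vector fields on $\mathbb{R}^n$ and let $H=\sum_j X_j^*X_j$ be the associated Hörmander Laplacian. Let $V$ be a smooth function on $\mathbb{R}^n$ (possibly changing sign). If there is a positive smooth function $u$ on $\mathbb{R}^n$ satisfying $Hu-Vu\geq 0$ in $\mathbb{R}^n$, then for every bounded regular domain $D\subset\mathbb{R}^n$, $$\lambda^H_1(D):=\inf\Big\{\int_D(|Xf|^2-Vf^2)\,dx \;:\; f\in C^1_0(D),\ \int_D f^2\,dx=1\Big\}>0.$$
   Context: Smooth vector fields $X_1,\dots,X_m$ on $\mathbb{R}^n$ are Hörmander vector fields if they together with their commutators up to some fixed length span $\mathbb{R}^n$ at every point. Writing $X_j=A^{jk}(x)\partial_{x^k}$, the formal adjoint is $X_j^*f=-\partial_{x^k}(A^{jk}f)$, and the Hörmander Laplacian is $H=\sum_j X_j^*X_j=-\sum_{i,k}\partial_{x^i}(a^{ik}\partial_{x^k})$ with $a^{ik}=\sum_jA^{ji}A^{jk}$. For $f\in C^1$, $|Xf|^2=\sum_j|X_jf|^2$. A bounded domain is called regular if its boundary has no characteristic points for $H$. Standing assumption of the paper: nonnegative solutions of $Hu-Vu=0$ satisfy the local Harnack inequality (for each point $x_0$ there are $R,C>0$ with $\sup_{B_d(x_0,R)}u\le C\inf_{B_d(x_0,R)}u$, $B_d$ the ball of the control (Carnot–Carathéodory) metric of the $X_j$); this is known to hold for smooth $V$. *)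

theory Defs
  imports "HOL-Analysis.Analysis"
begin

type_synonym 'n vfield = "real^'n \<Rightarrow> real^'n"

fun iter_dd :: "('a::real_normed_vector \<Rightarrow> 'b::real_normed_vector) \<Rightarrow> 'a list \<Rightarrow> 'a \<Rightarrow> 'b" where
  "iter_dd f [] = f"
| "iter_dd f (v # vs) = (\<lambda>x. frechet_derivative (iter_dd f vs) (at x) v)"

definition smooth :: "('a::real_normed_vector \<Rightarrow> 'b::real_normed_vector) \<Rightarrow> bool" where
  "smooth f \<longleftrightarrow> (\<forall>vs. iter_dd f vs differentiable_on UNIV)"

definition vf_apply :: "'n::finite vfield \<Rightarrow> (real^'n \<Rightarrow> real) \<Rightarrow> real^'n \<Rightarrow> real" where
  "vf_apply A f x = frechet_derivative f (at x) (A x)"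

definition lie_bracket :: "'n::finite vfield \<Rightarrow> 'n vfield \<Rightarrow> 'n vfield" where
  "lie_bracket X Y x = frechet_derivative Y (at x) (X x) - frechet_derivative X (at x) (Y x)"

inductive commutator :: "(nat \<Rightarrow> 'n::finite vfield) \<Rightarrow> nat \<Rightarrow> nat \<Rightarrow> 'n vfield \<Rightarrow> bool"
  for A m where
  gen: "j < m \<Longrightarrow> commutator A m 1 (A j)"
| brk: "commutator A m a Y \<Longrightarrow> commutator A m b Z \<Longrightarrow> commutator A m (a + b) (lie_bracket Y Z)"

definition hoermander :: "(nat \<Rightarrow> 'n::finite vfield) \<Rightarrow> nat \<Rightarrow> bool" where
  "hoermander A m \<longleftrightarrow> (\<forall>j<m. smooth (A j)) \<and>
     (\<exists>r. \<forall>x. span {Z x | Z k. k \<le> r \<and> commutator A m k Z} = UNIV)"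

definition divergence :: "'n::finite vfield \<Rightarrow> real^'n \<Rightarrow> real" where
  "divergence F x = (\<Sum>k\<in>UNIV. frechet_derivative F (at x) (axis k 1) $ k)"

definition vf_adjoint :: "'n::finite vfield \<Rightarrow> (real^'n \<Rightarrow> real) \<Rightarrow> real^'n \<Rightarrow> real" where
  "vf_adjoint A g x = - divergence (\<lambda>y. g y *\<^sub>R A y) x"

definition hoerm_lap :: "(nat \<Rightarrow> 'n::finite vfield) \<Rightarrow> nat \<Rightarrow> (real^'n \<Rightarrow> real) \<Rightarrow> real^'n \<Rightarrow> real" where
  "hoerm_lap A m u x = (\<Sum>j<m. vf_adjoint (A j) (vf_apply (A j) u) x)"

definition grad_X_sq :: "(nat \<Rightarrow> 'n::finite vfield) \<Rightarrow> nat \<Rightarrow> (real^'n \<Rightarrow> real) \<Rightarrow> real^'n \<Rightarrow> real" where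
  "grad_X_sq A m f x = (\<Sum>j<m. (vf_apply (A j) f x)\<^sup>2)"

text \<open>Bounded regular domain: bounded connected open set whose boundary is smooth
  (locally the zero set of a smooth defining function with nonvanishing gradient)
  and has no characteristic points (some X_j is transversal at every boundary point).\<close>
definition regular_domain :: "(nat \<Rightarrow> 'n::finite vfield) \<Rightarrow> nat \<Rightarrow> (real^'n) set \<Rightarrow> bool" where
  "regular_domain A m D \<longleftrightarrow> open D \<and> connected D \<and> D \<noteq> {} \<and> bounded D \<and>
     (\<forall>x\<in>frontier D. \<exists>U \<rho>. open U \<and> x \<in> U \<and> smooth (\<rho> :: real^'n \<Rightarrow> real) \<and>
        D \<inter> U = {y\<in>U. \<rho> y < 0} \<and> frechet_derivative \<rho> (at x) \<noteq> (\<lambda>v. 0) \<and>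
        (\<exists>j<m. vf_apply (A j) \<rho> x \<noteq> 0))"

definition C1_0 :: "(real^'n::finite) set \<Rightarrow> (real^'n \<Rightarrow> real) set" where
  "C1_0 D = {f. (\<exists>f'. (\<forall>x. (f has_derivative blinfun_apply (f' x)) (at x)) \<and> continuous_on UNIV f')
              \<and> compact (closure {x. f x \<noteq> 0}) \<and> closure {x. f x \<noteq> 0} \<subseteq> D}"

definition lambda1 :: "(nat \<Rightarrow> 'n::finite vfield) \<Rightarrow> nat \<Rightarrow> (real^'n \<Rightarrow> real) \<Rightarrow> (real^'n) set \<Rightarrow> ereal" where
  "lambda1 A m V D = Inf {ereal (integral D (\<lambda>x. grad_X_sq A m f x - V x * (f x)\<^sup>2)) | f.
                          f \<in> C1_0 D \<and> integral D (\<lambda>x. (f x)\<^sup>2) = 1}"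

end

theory Submission
  imports Defs
begin

text \<open>
  Picone's inequality: for smooth functions \<open>p\<^sub>j\<close> and \<open>f \<in> C\<^sup>1\<^sub>0(D)\<close>, expanding \<open>(X\<^sub>j f - p\<^sub>j f)\<^sup>2 \<ge> 0\<close> and
  integrating by parts gives \<open>\<integral> |Xf|\<^sup>2 \<ge> \<integral> (\<Sum>j. X\<^sub>j\<^sup>* p\<^sub>j - p\<^sub>j\<^sup>2) f\<^sup>2\<close>.  With
  \<open>p\<^sub>j = X\<^sub>j u / u + \<epsilon> h\<^sub>j / u\<^sup>2\<close> the weight equals
  \<open>H u / u + \<epsilon> (\<Sum>j. X\<^sub>j\<^sup>* h\<^sub>j) / u\<^sup>2 - \<epsilon>\<^sup>2 (\<Sum>j. h\<^sub>j\<^sup>2) / u\<^sup>4\<close>, so it suffices to find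
  \<open>h\<^sub>j\<close> for which \<open>\<Sum>j. X\<^sub>j\<^sup>* h\<^sub>j\<close> is positive on the compact closure of \<open>D\<close>.  Since
  \<open>[Y,Z]\<^sup>* = Z\<^sup>* Y\<^sup>* - Y\<^sup>* Z\<^sup>*\<close>, the functions of the form \<open>\<Sum>j. X\<^sub>j\<^sup>* h\<^sub>j\<close> include \<open>Z\<^sup>* h\<close> for every
  iterated commutator \<open>Z\<close>, and these commutators span at every point.
\<close>

subsection \<open>Smooth functions\<close>

text \<open>The direction comes first, so that \<open>dder v\<close> is an operator on functions
  that can be iterated; it is one step of \<open>iter_dd\<close>.\<close>

definition dder :: "'a::real_normed_vector \<Rightarrow> ('a \<Rightarrow> 'b::real_normed_vector) \<Rightarrow> 'a \<Rightarrow> 'b" where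
  "dder v f x = frechet_derivative f (at x) v"

abbreviation pd :: "'n::finite \<Rightarrow> (real^'n \<Rightarrow> real) \<Rightarrow> real^'n \<Rightarrow> real" where
  "pd k \<equiv> dder (axis k 1)"

lemma dder_eq: "(f has_derivative f') (at x) \<Longrightarrow> dder v f x = f' v"
  unfolding dder_def by (metis frechet_derivative_at)

text \<open>Every iterated derivative of \<open>f\<close> stays inside a class that is stable under
  directional derivatives. Smoothness thus reduces to exhibiting such a class of differentiable
  functions.\<close>

lemma smooth_coinduct:
  assumes "P f" and diff: "\<And>g x. P g \<Longrightarrow> g differentiable (at x)"
    and dder: "\<And>g v. P g \<Longrightarrow> P (dder v g)"
  shows "smooth f"
proof -
  have "P (iter_dd f vs)" for vs
  proof (induction vs)
    case Nil
    then show ?case using assms(1) by simp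
  next
    case (Cons v vs)
    then show ?case using dder[OF Cons, of v] by (simp add: dder_def[abs_def])
  qed
  then show ?thesis
    unfolding smooth_def by (auto intro!: differentiable_at_imp_differentiable_on diff)
qed

lemma smooth_differentiable: "smooth f \<Longrightarrow> f differentiable (at x)"
  unfolding smooth_def by (metis UNIV_I differentiable_on_def iter_dd.simps(1))

text \<open>\<open>iter_dd\<close> differentiates along the last entry of the list first, so
  appending at the end means replacing \<open>f\<close> by its derivative.\<close>

lemma iter_dd_append_single: "iter_dd f (vs @ [v]) = iter_dd (dder v f) vs"
  by (induction vs) (auto simp: dder_def)

lemma smooth_dder: "smooth f \<Longrightarrow> smooth (dder v f)"
  unfolding smooth_def by (metis iter_dd_append_single)

lemma smooth_continuous_on: "smooth f \<Longrightarrow> continuous_on S f"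
  using smooth_differentiable
  by (metis continuous_at_imp_continuous_on differentiable_imp_continuous_within)

lemma smooth_has_derivative: "smooth f \<Longrightarrow> (f has_derivative (\<lambda>v. dder v f x)) (at x)"
  using smooth_differentiable[of f x] frechet_derivative_works
  by (simp add: dder_def[abs_def]) blast

text \<open>The derivative of a product is a sum of products, and that of a reciprocal involves
  products of reciprocals. No single operation gives a class stable under differentiation, but
  closing under all of them at once does.\<close>

inductive smooth_alg :: "('a::real_normed_vector \<Rightarrow> real) \<Rightarrow> bool" where
  base: "smooth f \<Longrightarrow> smooth_alg f"
| const: "smooth_alg (\<lambda>x. c)"
| linear: "bounded_linear f \<Longrightarrow> smooth_alg f"
| add: "smooth_alg f \<Longrightarrow> smooth_alg g \<Longrightarrow> smooth_alg (\<lambda>x. f x + g x)"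
| mult: "smooth_alg f \<Longrightarrow> smooth_alg g \<Longrightarrow> smooth_alg (\<lambda>x. f x * g x)"
| exp: "smooth_alg f \<Longrightarrow> smooth_alg (\<lambda>x. exp (f x))"
| inverse: "smooth_alg f \<Longrightarrow> (\<And>x. f x \<noteq> 0) \<Longrightarrow> smooth_alg (\<lambda>x. inverse (f x))"

text \<open>Both conclusions go through one induction: the calculus rules need the derivatives of
  the parts, and the resulting formulas are again built from members of the class.\<close>

lemma smooth_alg_dder:
  assumes "smooth_alg f"
  shows "(\<forall>x. (f has_derivative (\<lambda>v. dder v f x)) (at x)) \<and> (\<forall>v. smooth_alg (dder v f))"
  using assms
proof (induction rule: smooth_alg.induct)
  case (base f)
  then show ?case using smooth_has_derivative smooth_dder smooth_alg.base by blast
next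
  case (const c)
  have "dder v (\<lambda>x. c) = (\<lambda>x. 0)" for v :: 'a
    by (auto simp: dder_def)
  then show ?case by (auto intro: smooth_alg.const)
next
  case (linear f)
  have *: "(f has_derivative f) (at x)" for x
    by (rule bounded_linear_imp_has_derivative[OF linear])
  have "dder v f = (\<lambda>x. f v)" for v
    using dder_eq[OF *] by auto
  with * show ?case by (auto intro: smooth_alg.const)
next
  case (add f g)
  have *: "((\<lambda>x. f x + g x) has_derivative (\<lambda>v. dder v f x + dder v g x)) (at x)" for x
    using add by (auto intro!: derivative_intros)
  have "dder v (\<lambda>x. f x + g x) = (\<lambda>x. dder v f x + dder v g x)" for v
    using dder_eq[OF *] by auto
  with * add show ?case by (auto intro: smooth_alg.add)
next
  case (mult f g)
  have *: "((\<lambda>x. f x * g x) has_derivative (\<lambda>v. f x * dder v g x + dder v f x * g x)) (at x)" for x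
    using mult by (auto intro!: derivative_intros)
  have "dder v (\<lambda>x. f x * g x) = (\<lambda>x. f x * dder v g x + dder v f x * g x)" for v
    using dder_eq[OF *] by auto
  with * mult show ?case by (auto intro!: smooth_alg.add smooth_alg.mult)
next
  case (exp f)
  have *: "((\<lambda>x. exp (f x)) has_derivative (\<lambda>v. dder v f x * exp (f x))) (at x)" for x
    using exp by (auto intro!: derivative_eq_intros)
  have "dder v (\<lambda>x. exp (f x)) = (\<lambda>x. dder v f x * exp (f x))" for v
    using dder_eq[OF *] by auto
  with * exp show ?case by (auto intro: smooth_alg.exp smooth_alg.mult)
next
  case (inverse f)
  have *: "((\<lambda>x. inverse (f x)) has_derivative
      (\<lambda>v. (- 1) * (inverse (f x) * dder v f x * inverse (f x)))) (at x)" for x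
    using inverse by (auto intro!: derivative_eq_intros)
  have "dder v (\<lambda>x. inverse (f x)) = (\<lambda>x. (- 1) * (inverse (f x) * dder v f x * inverse (f x)))" for v
    using dder_eq[OF *] by auto
  with * inverse show ?case
    by (auto intro!: smooth_alg.inverse smooth_alg.mult smooth_alg.const simp only: )
qed

lemma smooth_alg_smooth: "smooth_alg f \<Longrightarrow> smooth f"
  by (rule smooth_coinduct[where P = smooth_alg])
    (use smooth_alg_dder differentiable_def in blast)+

named_theorems smooth_intros

section \<open>Closure and differentiation rules for real-valued smooth functions\<close>

lemma smooth_const [smooth_intros]: "smooth (\<lambda>x. c::real)"
  and smooth_add [smooth_intros]: "smooth f \<Longrightarrow> smooth g \<Longrightarrow> smooth (\<lambda>x. f x + g x :: real)"
  and smooth_mult [smooth_intros]: "smooth f \<Longrightarrow> smooth g \<Longrightarrow> smooth (\<lambda>x. f x * g x :: real)"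
  and smooth_exp [smooth_intros]: "smooth f \<Longrightarrow> smooth (\<lambda>x. exp (f x) :: real)"
  and smooth_inverse [smooth_intros]:
    "smooth f \<Longrightarrow> (\<And>x. f x \<noteq> 0) \<Longrightarrow> smooth (\<lambda>x. inverse (f x :: real))"
  and smooth_linear: "bounded_linear f \<Longrightarrow> smooth (f :: _ \<Rightarrow> real)"
  by (auto intro: smooth_alg_smooth smooth_alg.intros)

lemma smooth_minus [smooth_intros]: "smooth f \<Longrightarrow> smooth (\<lambda>x. - f x :: real)"
  using smooth_mult[OF smooth_const[of "- 1"], of f] by simp

lemma smooth_diff [smooth_intros]:
  "smooth f \<Longrightarrow> smooth g \<Longrightarrow> smooth (\<lambda>x. f x - g x :: real)"
  using smooth_add[OF _ smooth_minus, of f g] by simp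

lemma smooth_sum [smooth_intros]:
  "(\<And>i. i \<in> I \<Longrightarrow> smooth (f i)) \<Longrightarrow> smooth (\<lambda>x. \<Sum>i\<in>I. f i x :: real)"
  by (induction I rule: infinite_finite_induct) (auto intro: smooth_intros)

lemma smooth_power [smooth_intros]: "smooth f \<Longrightarrow> smooth (\<lambda>x. f x ^ n :: real)"
  by (induction n) (auto intro: smooth_intros)

lemma smooth_coord [smooth_intros]: "smooth (\<lambda>x::real^'n::finite. x $ k)"
  by (rule smooth_linear) (rule bounded_linear_vec_nth)

lemmas [smooth_intros] = smooth_dder

lemma dder_const: "dder v (\<lambda>x. c) x = 0"
  by (simp add: dder_def)

lemma dder_add:
  "smooth f \<Longrightarrow> smooth g \<Longrightarrow> dder v (\<lambda>x. f x + g x :: real) x = dder v f x + dder v g x"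
  by (rule dder_eq) (intro derivative_intros smooth_has_derivative)

lemma dder_diff:
  "smooth f \<Longrightarrow> smooth g \<Longrightarrow> dder v (\<lambda>x. f x - g x :: real) x = dder v f x - dder v g x"
  by (rule dder_eq) (intro derivative_intros smooth_has_derivative)

lemma dder_sum:
  "(\<And>i. i \<in> I \<Longrightarrow> smooth (f i)) \<Longrightarrow>
    dder v (\<lambda>x. \<Sum>i\<in>I. f i x :: real) x = (\<Sum>i\<in>I. dder v (f i) x)"
  by (rule dder_eq) (intro derivative_intros smooth_has_derivative)

lemma dder_mult:
  "smooth f \<Longrightarrow> smooth g \<Longrightarrow>
    dder v (\<lambda>x. f x * g x :: real) x = f x * dder v g x + dder v f x * g x"
  by (rule dder_eq) (intro derivative_intros smooth_has_derivative)

section \<open>Symmetry of mixed second derivatives\<close>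

lemma mean_value_line:
  fixes f :: "'a::real_normed_vector \<Rightarrow> real"
  assumes "smooth f" "t > 0"
  shows "\<exists>s. 0 < s \<and> s < t \<and> f (x + t *\<^sub>R v) - f x = t * dder v f (x + s *\<^sub>R v)"
proof -
  have "((\<lambda>s. f (x + s *\<^sub>R v)) has_real_derivative dder v f (x + s *\<^sub>R v)) (at s)" for s
  proof -
    have "((\<lambda>s. f (x + s *\<^sub>R v)) has_derivative (\<lambda>r. dder (r *\<^sub>R v) f (x + s *\<^sub>R v))) (at s)"
      by (rule has_derivative_compose[OF _ smooth_has_derivative[OF assms(1)]])
        (auto intro!: derivative_eq_intros)
    moreover have "dder (r *\<^sub>R v) f y = dder v f y * r" for r y
      using linear_frechet_derivative[OF smooth_differentiable[OF assms(1)], of y]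
      by (simp add: dder_def linear_scale)
    ultimately show ?thesis by (simp add: has_field_derivative_def)
  qed
  from MVT2[OF assms(2) this] show ?thesis by auto
qed

text \<open>The second difference of \<open>f\<close> over the parallelogram with sides
  \<open>t a\<close> and \<open>t b\<close> is symmetric in \<open>a\<close> and \<open>b\<close>.
  Two applications of the mean value theorem turn it into \<open>t * t\<close> times a mixed
  derivative near \<open>x\<close>, in either order. Continuity of both mixed derivatives then
  forces equality at \<open>x\<close>.\<close>

lemma dder_commute:
  fixes f :: "'a::real_normed_vector \<Rightarrow> real"
  assumes "smooth f"
  shows "dder a (dder b f) x = dder b (dder a f) x"
proof (rule ccontr)
  assume ne: "dder a (dder b f) x \<noteq> dder b (dder a f) x"
  have 1: "\<exists>s r. 0 < s \<and> s < t \<and> 0 < r \<and> r < t \<and>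
      f (x + t *\<^sub>R a + t *\<^sub>R b) - f (x + t *\<^sub>R a) - f (x + t *\<^sub>R b) + f x
        = t * (t * dder b (dder a f) (x + s *\<^sub>R a + r *\<^sub>R b))"
    if "t > 0" for t :: real and a b
  proof -
    let ?g = "\<lambda>y. f (y + t *\<^sub>R b) - f y"
    have d: "((\<lambda>y. f (y + t *\<^sub>R b)) has_derivative (\<lambda>v. dder v f (y + t *\<^sub>R b))) (at y)" for y
      by (rule has_derivative_compose[OF _ smooth_has_derivative[OF assms(1)]])
        (auto intro!: derivative_eq_intros)
    have dg: "dder v (\<lambda>y. f (y + t *\<^sub>R b)) y = dder v f (y + t *\<^sub>R b)" for v y
      by (rule dder_eq[OF d])
    \<comment> \<open>Translates of smooth functions form a class stable under
      differentiation.\<close>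
    have sm: "smooth (\<lambda>y. f (y + t *\<^sub>R b))"
    proof (rule smooth_coinduct[where P = "\<lambda>h. \<exists>k. smooth k \<and> h = (\<lambda>y. k (y + t *\<^sub>R b))"])
      show "\<exists>k. smooth k \<and> (\<lambda>y. f (y + t *\<^sub>R b)) = (\<lambda>y. k (y + t *\<^sub>R b))"
        using assms by blast
    next
      fix h :: "'a \<Rightarrow> real" and v y
      assume "\<exists>k. smooth k \<and> h = (\<lambda>y. k (y + t *\<^sub>R b))"
      then obtain k where k: "smooth k" "h = (\<lambda>y. k (y + t *\<^sub>R b))" by blast
      have d: "(h has_derivative (\<lambda>v. dder v k (y + t *\<^sub>R b))) (at y)" for y
        unfolding k by (rule has_derivative_compose[OF _ smooth_has_derivative[OF k(1)]])
          (auto intro!: derivative_eq_intros)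
      show "h differentiable at y" using d differentiable_def by blast
      show "\<exists>k. smooth k \<and> dder v h = (\<lambda>y. k (y + t *\<^sub>R b))"
        using dder_eq[OF d] smooth_dder[OF k(1)] by blast
    qed
    obtain s where s: "0 < s" "s < t" "?g (x + t *\<^sub>R a) - ?g x = t * dder a ?g (x + s *\<^sub>R a)"
      using mean_value_line[OF smooth_diff[OF sm assms] \<open>t > 0\<close>] by blast
    obtain r where r: "0 < r" "r < t" "dder a f ((x + s *\<^sub>R a) + t *\<^sub>R b) - dder a f (x + s *\<^sub>R a)
        = t * dder b (dder a f) ((x + s *\<^sub>R a) + r *\<^sub>R b)"
      using mean_value_line[OF smooth_dder[OF assms] \<open>t > 0\<close>] by blast
    have "dder a ?g (x + s *\<^sub>R a) = dder a f ((x + s *\<^sub>R a) + t *\<^sub>R b) - dder a f (x + s *\<^sub>R a)"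
      using dder_diff[OF sm assms] dg by simp
    with s r show ?thesis
      by (intro exI[of _ s] exI[of _ r]) (auto simp: algebra_simps)
  qed
  \<comment> \<open>Half of the supposed gap: no number is closer than \<open>e\<close> to both
    mixed derivatives at \<open>x\<close>.\<close>
  define e where "e = \<bar>dder a (dder b f) x - dder b (dder a f) x\<bar> / 2"
  have e: "e > 0" using ne by (simp add: e_def)
  have cont: "\<exists>d>0. \<forall>y. dist y x < d \<longrightarrow> dist (h y) (h x) < e" if "smooth h" for h :: "'a \<Rightarrow> real"
    using smooth_continuous_on[OF that, of UNIV] e unfolding continuous_on_iff by blast
  obtain d1 where d1: "d1 > 0" "\<And>y. dist y x < d1 \<Longrightarrow> dist (dder a (dder b f) y) (dder a (dder b f) x) < e"
    using cont[of "dder a (dder b f)"] smooth_dder assms by blast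
  obtain d2 where d2: "d2 > 0" "\<And>y. dist y x < d2 \<Longrightarrow> dist (dder b (dder a f) y) (dder b (dder a f) x) < e"
    using cont[of "dder b (dder a f)"] smooth_dder assms by blast
  \<comment> \<open>All intermediate points lie within \<open>t * (norm a + norm b)\<close> of
    \<open>x\<close>; the summand 1 keeps the denominator positive and makes the bound by
    \<open>min d1 d2\<close> strict.\<close>
  define t where "t = min d1 d2 / (norm a + norm b + 1)"
  have pos: "norm a + norm b + 1 > 0" by (smt (verit) norm_ge_zero)
  have t: "t > 0" using d1 d2 pos by (simp add: t_def)
  \<comment> \<open>Only the sum of the two norms is fixed, so that the estimate serves both orders
    of \<open>a\<close> and \<open>b\<close>.\<close>
  have near: "dist (x + s *\<^sub>R v + r *\<^sub>R w) x < min d1 d2"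
    if "0 < s" "s < t" "0 < r" "r < t" "norm v + norm w = norm a + norm b" for s r v w
  proof -
    have "dist (x + s *\<^sub>R v + r *\<^sub>R w) x = norm (s *\<^sub>R v + r *\<^sub>R w)" by (simp add: dist_norm add.assoc)
    also have "\<dots> \<le> s * norm v + r * norm w"
      using norm_triangle_ineq[of "s *\<^sub>R v" "r *\<^sub>R w"] that by simp
    also have "\<dots> \<le> t * norm v + t * norm w"
      using that by (intro add_mono mult_right_mono) auto
    also have "\<dots> < t * (norm a + norm b + 1)"
      using t that(5) by (simp flip: distrib_left)
    also have "\<dots> = min d1 d2" using pos by (simp add: t_def)
    finally show ?thesis .
  qed
  obtain s r where sr: "0 < s" "s < t" "0 < r" "r < t"
     "f (x + t *\<^sub>R a + t *\<^sub>R b) - f (x + t *\<^sub>R a) - f (x + t *\<^sub>R b) + f x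
        = t * (t * dder b (dder a f) (x + s *\<^sub>R a + r *\<^sub>R b))"
    using 1[OF t, of a b] by blast
  obtain s' r' where sr': "0 < s'" "s' < t" "0 < r'" "r' < t"
     "f (x + t *\<^sub>R b + t *\<^sub>R a) - f (x + t *\<^sub>R b) - f (x + t *\<^sub>R a) + f x
        = t * (t * dder a (dder b f) (x + s' *\<^sub>R b + r' *\<^sub>R a))"
    using 1[OF t, of b a] by blast
  have "t * (t * dder b (dder a f) (x + s *\<^sub>R a + r *\<^sub>R b))
      = t * (t * dder a (dder b f) (x + s' *\<^sub>R b + r' *\<^sub>R a))"
    unfolding sr(5)[symmetric] sr'(5)[symmetric] by (simp add: algebra_simps)
  then have eq: "dder b (dder a f) (x + s *\<^sub>R a + r *\<^sub>R b) = dder a (dder b f) (x + s' *\<^sub>R b + r' *\<^sub>R a)"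
    using t by simp
  have "dist (dder b (dder a f) (x + s *\<^sub>R a + r *\<^sub>R b)) (dder b (dder a f) x) < e"
    by (rule d2(2)) (use near[OF sr(1-4), of a b] in simp)
  moreover have "dist (dder a (dder b f) (x + s' *\<^sub>R b + r' *\<^sub>R a)) (dder a (dder b f) x) < e"
    by (rule d1(2)) (use near[OF sr'(1-4), of b a] in simp)
  ultimately show False
    using eq unfolding e_def dist_real_def by (auto simp: abs_if split: if_splits)
qed

subsection \<open>Vector fields and their formal adjoints\<close>

text \<open>Smoothness is required component by component because the closure rules above concern
  real-valued functions.\<close>

definition smooth_field :: "(real^'n::finite \<Rightarrow> real^'n) \<Rightarrow> bool" where
  "smooth_field F \<longleftrightarrow> (\<forall>k. smooth (\<lambda>x. F x $ k))"

lemma smooth_fieldD [smooth_intros]: "smooth_field F \<Longrightarrow> smooth (\<lambda>x. F x $ k)"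
  by (simp add: smooth_field_def)

text \<open>Taking a component commutes with directional derivatives, so the components of smooth
  maps form a class to which \<open>smooth_coinduct\<close> applies.\<close>

lemma smooth_imp_smooth_field:
  fixes F :: "real^'n::finite \<Rightarrow> real^'n"
  assumes "smooth F"
  shows "smooth_field F"
  unfolding smooth_field_def
proof
  fix k
  show "smooth (\<lambda>x. F x $ k)"
  proof (rule smooth_coinduct[where P = "\<lambda>h. \<exists>G :: real^'n \<Rightarrow> real^'n. smooth G \<and> h = (\<lambda>x. G x $ k)"])
    show "\<exists>G :: real^'n \<Rightarrow> real^'n. smooth G \<and> (\<lambda>x. F x $ k) = (\<lambda>x. G x $ k)"
      using assms by blast
  next
    fix h :: "real^'n \<Rightarrow> real" and v y
    assume "\<exists>G :: real^'n \<Rightarrow> real^'n. smooth G \<and> h = (\<lambda>x. G x $ k)"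
    then obtain G :: "real^'n \<Rightarrow> real^'n" where G: "smooth G" "h = (\<lambda>x. G x $ k)" by blast
    have d: "(h has_derivative (\<lambda>v. dder v G y $ k)) (at y)" for y
      unfolding G by (rule bounded_linear.has_derivative[OF bounded_linear_vec_nth smooth_has_derivative[OF G(1)]])
    show "h differentiable at y" using d differentiable_def by blast
    show "\<exists>G :: real^'n \<Rightarrow> real^'n. smooth G \<and> dder v h = (\<lambda>x. G x $ k)"
      using dder_eq[OF d] smooth_dder[OF G(1)] by blast
  qed
qed

lemma has_derivative_field:
  fixes F :: "real^'n::finite \<Rightarrow> real^'n"
  assumes "\<And>k. ((\<lambda>y. F y $ k) has_derivative (\<lambda>v. f' v k)) (at x)"
  shows "(F has_derivative (\<lambda>v. \<chi> k. f' v k)) (at x)"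
  by (subst has_derivative_componentwise_within)
    (use assms in \<open>auto simp: Basis_vec_def inner_axis\<close>)

lemma linear_eq_sum_axis:
  fixes L :: "real^'n::finite \<Rightarrow> real"
  assumes "linear L"
  shows "L v = (\<Sum>k\<in>UNIV. v $ k * L (axis k 1))"
proof -
  have "L v = L (\<Sum>k\<in>UNIV. v $ k *\<^sub>R axis k 1)"
    using basis_expansion[of v] by (simp add: scalar_mult_eq_scaleR)
  then show ?thesis
    by (simp add: linear_sum[OF assms] linear_scale[OF assms])
qed

lemma vf_apply_eq:
  assumes "f differentiable (at x)"
  shows "vf_apply X f x = (\<Sum>k\<in>UNIV. X x $ k * pd k f x)"
  unfolding vf_apply_def dder_def
  by (rule linear_eq_sum_axis[OF linear_frechet_derivative[OF assms]])

lemma divergence_eq: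
  assumes "\<And>k. (\<lambda>y. F y $ k) differentiable (at x)"
  shows "divergence F x = (\<Sum>k\<in>UNIV. pd k (\<lambda>y. F y $ k) x)"
proof -
  have "(F has_derivative (\<lambda>v. \<chi> k. dder v (\<lambda>y. F y $ k) x)) (at x)"
    using assms unfolding dder_def frechet_derivative_works by (intro has_derivative_field)
  from dder_eq[OF this] show ?thesis by (simp add: divergence_def dder_def)
qed

lemma lie_bracket_nth:
  assumes "smooth_field Y" "smooth_field Z"
  shows "lie_bracket Y Z x $ k =
    (\<Sum>i\<in>UNIV. Y x $ i * pd i (\<lambda>y. Z y $ k) x - Z x $ i * pd i (\<lambda>y. Y y $ k) x)"
proof -
  have *: "frechet_derivative F (at x) v $ k = (\<Sum>i\<in>UNIV. v $ i * pd i (\<lambda>y. F y $ k) x)"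
    if "smooth_field F" for F :: "real^'a \<Rightarrow> real^'a" and v
  proof -
    have "(F has_derivative (\<lambda>v. \<chi> k. dder v (\<lambda>y. F y $ k) x)) (at x)"
      using that by (intro has_derivative_field smooth_has_derivative smooth_fieldD)
    from dder_eq[OF this, of v] have "frechet_derivative F (at x) v $ k = dder v (\<lambda>y. F y $ k) x"
      by (simp add: dder_def)
    also have "\<dots> = (\<Sum>i\<in>UNIV. v $ i * pd i (\<lambda>y. F y $ k) x)"
      unfolding dder_def using that
      by (intro linear_eq_sum_axis linear_frechet_derivative smooth_differentiable smooth_fieldD)
    finally show ?thesis .
  qed
  show ?thesis
    unfolding lie_bracket_def using *[OF assms(1)] *[OF assms(2)] by (simp add: sum_subtractf)
qed

lemma smooth_field_lie_bracket:
  "smooth_field Y \<Longrightarrow> smooth_field Z \<Longrightarrow> smooth_field (lie_bracket Y Z)"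
  unfolding smooth_field_def[of "lie_bracket Y Z"]
  by (simp add: lie_bracket_nth) (intro allI smooth_intros)

lemma smooth_vf_apply [smooth_intros]: "smooth_field X \<Longrightarrow> smooth f \<Longrightarrow> smooth (vf_apply X f)"
proof -
  assume *: "smooth_field X" "smooth f"
  then have "vf_apply X f = (\<lambda>x. \<Sum>k\<in>UNIV. X x $ k * pd k f x)"
    by (simp add: fun_eq_iff vf_apply_eq smooth_differentiable)
  then show ?thesis using * by (simp add: smooth_intros)
qed

lemma divergence_smooth_field:
  "smooth_field F \<Longrightarrow> divergence F x = (\<Sum>k\<in>UNIV. pd k (\<lambda>y. F y $ k) x)"
  by (intro divergence_eq smooth_differentiable smooth_fieldD)

lemma smooth_divergence [smooth_intros]:
  assumes "smooth_field F"
  shows "smooth (divergence F)"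
proof -
  have "divergence F = (\<lambda>x. \<Sum>k\<in>UNIV. pd k (\<lambda>y. F y $ k) x)"
    using assms by (simp add: fun_eq_iff divergence_smooth_field)
  then show ?thesis using assms by (simp add: smooth_intros)
qed

text \<open>Leibniz rule for the divergence. It splits the adjoint into a derivation and a
  multiplication operator, the form from which the later adjoint rules are computed.\<close>

lemma vf_adjoint_eq:
  assumes "smooth_field X" "smooth h"
  shows "vf_adjoint X h x = - (vf_apply X h x + h x * divergence X x)"
proof -
  have s: "smooth_field (\<lambda>y. h y *\<^sub>R X y)"
    unfolding smooth_field_def using assms by (auto intro: smooth_intros)
  have "divergence (\<lambda>y. h y *\<^sub>R X y) x = (\<Sum>k\<in>UNIV. h x * pd k (\<lambda>y. X y $ k) x + X x $ k * pd k h x)"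
    unfolding divergence_smooth_field[OF s] using assms
    by (simp add: dder_mult smooth_intros mult.commute)
  also have "\<dots> = h x * divergence X x + vf_apply X h x"
    using assms by (simp add: divergence_smooth_field vf_apply_eq smooth_differentiable
        sum.distrib sum_distrib_left)
  finally show ?thesis by (simp add: vf_adjoint_def)
qed

lemma smooth_vf_adjoint [smooth_intros]:
  assumes "smooth_field X" "smooth h"
  shows "smooth (vf_adjoint X h)"
proof -
  have "vf_adjoint X h = (\<lambda>x. - (vf_apply X h x + h x * divergence X x))"
    using assms by (simp add: fun_eq_iff vf_adjoint_eq)
  then show ?thesis using assms by (simp add: smooth_intros)
qed

section \<open>Algebraic rules for derivations, and the effect of a bracket on derivation,
  divergence and adjoint\<close>

lemma vf_apply_add:
  assumes "smooth f" "smooth g"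
  shows "vf_apply X (\<lambda>x. f x + g x) x = vf_apply X f x + vf_apply X g x"
  using dder_add[OF assms] by (simp add: vf_apply_def dder_def)

lemma vf_apply_mult:
  assumes "smooth f" "smooth g"
  shows "vf_apply X (\<lambda>x. f x * g x) x = f x * vf_apply X g x + vf_apply X f x * g x"
  using dder_mult[OF assms] by (simp add: vf_apply_def dder_def)

lemma vf_apply_minus:
  assumes "smooth f"
  shows "vf_apply X (\<lambda>x. - f x) x = - vf_apply X f x"
  using dder_diff[OF smooth_const[of 0] assms] dder_const by (simp add: vf_apply_def dder_def)

text \<open>Both compositions have the same second-order part, by symmetry of second derivatives, so
  it cancels; what remains are the first-order coefficients of the bracket.\<close>

lemma vf_apply_lie_bracket:
  assumes Y: "smooth_field Y" and Z: "smooth_field Z" and h: "smooth h"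
  shows "vf_apply (lie_bracket Y Z) h x = vf_apply Y (vf_apply Z h) x - vf_apply Z (vf_apply Y h) x"
proof -
  \<comment> \<open>First-order and second-order parts are separated for generic fields, to be used
    in both orders.\<close>
  have *: "vf_apply Y (vf_apply Z h) x =
      (\<Sum>i\<in>UNIV. \<Sum>k\<in>UNIV. Y x $ i * pd i (\<lambda>y. Z y $ k) x * pd k h x)
      + (\<Sum>i\<in>UNIV. \<Sum>k\<in>UNIV. Y x $ i * Z x $ k * pd i (pd k h) x)"
    if Y: "smooth_field Y" and Z: "smooth_field Z" for Y Z
  proof -
    have e: "vf_apply Z h = (\<lambda>x. \<Sum>k\<in>UNIV. Z x $ k * pd k h x)"
      using h by (simp add: fun_eq_iff vf_apply_eq smooth_differentiable)
    have "vf_apply Y (vf_apply Z h) x = (\<Sum>i\<in>UNIV. Y x $ i * pd i (vf_apply Z h) x)"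
      using Z h by (intro vf_apply_eq smooth_differentiable smooth_intros)
    also have "\<dots> = (\<Sum>i\<in>UNIV. \<Sum>k\<in>UNIV. Y x $ i * pd i (\<lambda>y. Z y $ k) x * pd k h x
        + Y x $ i * Z x $ k * pd i (pd k h) x)"
      unfolding e using Z h
      by (simp add: dder_sum dder_mult smooth_intros sum_distrib_left algebra_simps)
    finally show ?thesis by (simp add: sum.distrib)
  qed
  have sw: "(\<Sum>i\<in>UNIV. \<Sum>k\<in>UNIV. Z x $ i * Y x $ k * pd i (pd k h) x)
      = (\<Sum>i\<in>UNIV. \<Sum>k\<in>UNIV. Y x $ i * Z x $ k * pd i (pd k h) x)"
    by (subst sum.swap) (simp add: dder_commute[OF h] mult.commute)
  have "vf_apply (lie_bracket Y Z) h x
      = (\<Sum>k\<in>UNIV. \<Sum>i\<in>UNIV. Y x $ i * pd i (\<lambda>y. Z y $ k) x * pd k h x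
          - Z x $ i * pd i (\<lambda>y. Y y $ k) x * pd k h x)"
    using h by (simp add: vf_apply_eq smooth_differentiable lie_bracket_nth[OF Y Z]
        sum_distrib_right left_diff_distrib)
  also have "\<dots> = (\<Sum>i\<in>UNIV. \<Sum>k\<in>UNIV. Y x $ i * pd i (\<lambda>y. Z y $ k) x * pd k h x)
      - (\<Sum>i\<in>UNIV. \<Sum>k\<in>UNIV. Z x $ i * pd i (\<lambda>y. Y y $ k) x * pd k h x)"
    by (subst sum.swap) (simp add: sum_subtractf)
  finally show ?thesis
    unfolding *[OF Y Z] *[OF Z Y] sw by simp
qed

text \<open>The products of first derivatives of \<open>Y\<close> and \<open>Z\<close> agree after
  exchanging the summation indices and cancel. The second-derivative terms become derivatives of the
  two divergences once the order of differentiation is exchanged.\<close>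

lemma divergence_lie_bracket:
  assumes Y: "smooth_field Y" and Z: "smooth_field Z"
  shows "divergence (lie_bracket Y Z) x = vf_apply Y (divergence Z) x - vf_apply Z (divergence Y) x"
proof -
  have *: "vf_apply Y (divergence Z) x =
      (\<Sum>i\<in>UNIV. \<Sum>k\<in>UNIV. Y x $ i * pd i (pd k (\<lambda>y. Z y $ k)) x)"
    if Y: "smooth_field Y" and Z: "smooth_field Z" for Y Z
  proof -
    have e: "divergence Z = (\<lambda>x. \<Sum>k\<in>UNIV. pd k (\<lambda>y. Z y $ k) x)"
      using Z by (simp add: fun_eq_iff divergence_smooth_field)
    have "vf_apply Y (divergence Z) x = (\<Sum>i\<in>UNIV. Y x $ i * pd i (divergence Z) x)"
      using Z by (intro vf_apply_eq smooth_differentiable smooth_intros)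
    then show ?thesis
      unfolding e using Z by (simp add: dder_sum smooth_intros sum_distrib_left)
  qed
  have e: "(\<lambda>y. lie_bracket Y Z y $ k) = (\<lambda>x. \<Sum>i\<in>UNIV. Y x $ i * pd i (\<lambda>y. Z y $ k) x
      - Z x $ i * pd i (\<lambda>y. Y y $ k) x)" for k
    by (simp add: fun_eq_iff lie_bracket_nth[OF Y Z])
  have "divergence (lie_bracket Y Z) x
      = (\<Sum>k\<in>UNIV. \<Sum>i\<in>UNIV. (Y x $ i * pd k (pd i (\<lambda>y. Z y $ k)) x
          + pd k (\<lambda>y. Y y $ i) x * pd i (\<lambda>y. Z y $ k) x)
          - (Z x $ i * pd k (pd i (\<lambda>y. Y y $ k)) x + pd k (\<lambda>y. Z y $ i) x * pd i (\<lambda>y. Y y $ k) x))"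
    unfolding divergence_smooth_field[OF smooth_field_lie_bracket[OF Y Z]] e
    using Y Z by (simp add: dder_sum dder_diff dder_mult smooth_intros)
  also have "\<dots> = (\<Sum>k\<in>UNIV. \<Sum>i\<in>UNIV. Y x $ i * pd k (pd i (\<lambda>y. Z y $ k)) x)
      + (\<Sum>k\<in>UNIV. \<Sum>i\<in>UNIV. pd k (\<lambda>y. Y y $ i) x * pd i (\<lambda>y. Z y $ k) x)
      - (\<Sum>k\<in>UNIV. \<Sum>i\<in>UNIV. Z x $ i * pd k (pd i (\<lambda>y. Y y $ k)) x)
      - (\<Sum>k\<in>UNIV. \<Sum>i\<in>UNIV. pd k (\<lambda>y. Z y $ i) x * pd i (\<lambda>y. Y y $ k) x)"
    by (simp add: sum.distrib sum_subtractf)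
  also have "(\<Sum>k\<in>UNIV. \<Sum>i\<in>UNIV. Y x $ i * pd k (pd i (\<lambda>y. Z y $ k)) x) = vf_apply Y (divergence Z) x"
    unfolding *[OF Y Z]
    by (subst sum.swap) (simp add: dder_commute[OF smooth_fieldD[OF Z]])
  also have "(\<Sum>k\<in>UNIV. \<Sum>i\<in>UNIV. Z x $ i * pd k (pd i (\<lambda>y. Y y $ k)) x) = vf_apply Z (divergence Y) x"
    unfolding *[OF Z Y]
    by (subst sum.swap) (simp add: dder_commute[OF smooth_fieldD[OF Y]])
  also have "(\<Sum>k\<in>UNIV. \<Sum>i\<in>UNIV. pd k (\<lambda>y. Z y $ i) x * pd i (\<lambda>y. Y y $ k) x)
      = (\<Sum>k\<in>UNIV. \<Sum>i\<in>UNIV. pd k (\<lambda>y. Y y $ i) x * pd i (\<lambda>y. Z y $ k) x)"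
    by (subst sum.swap) (simp add: mult.commute)
  finally show ?thesis by simp
qed

text \<open>Formally this is the adjoint of \<open>Y Z - Z Y\<close>. Since
  \<open>vf_adjoint\<close> is a pointwise formula, it is checked by expansion: the terms symmetric
  in \<open>Y\<close> and \<open>Z\<close> cancel, and the others are given by the two preceding
  bracket rules.\<close>

lemma vf_adjoint_lie_bracket:
  assumes Y: "smooth_field Y" and Z: "smooth_field Z" and h: "smooth h"
  shows "vf_adjoint (lie_bracket Y Z) h x
    = vf_adjoint Z (vf_adjoint Y h) x - vf_adjoint Y (vf_adjoint Z h) x"
proof -
  have *: "vf_adjoint Z (vf_adjoint Y h) x = vf_apply Z (vf_apply Y h) x
      + h x * vf_apply Z (divergence Y) x + vf_apply Z h x * divergence Y x
      + (vf_apply Y h x + h x * divergence Y x) * divergence Z x"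
    if Y: "smooth_field Y" and Z: "smooth_field Z" for Y Z
  proof -
    have e: "vf_adjoint Y h = (\<lambda>x. - (vf_apply Y h x + h x * divergence Y x))"
      using Y h by (simp add: fun_eq_iff vf_adjoint_eq)
    have "vf_adjoint Z (vf_adjoint Y h) x
        = - (vf_apply Z (vf_adjoint Y h) x + vf_adjoint Y h x * divergence Z x)"
      using Y Z h by (intro vf_adjoint_eq smooth_intros)
    also have "vf_apply Z (vf_adjoint Y h) x = - (vf_apply Z (vf_apply Y h) x
      + (h x * vf_apply Z (divergence Y) x + vf_apply Z h x * divergence Y x))"
      unfolding e using Y Z h by (simp add: vf_apply_minus vf_apply_add vf_apply_mult smooth_intros del: minus_add_distrib)
    finally show ?thesis by (simp add: e algebra_simps)
  qed
  show ?thesis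
    unfolding vf_adjoint_eq[OF smooth_field_lie_bracket[OF Y Z] h] *[OF Y Z] *[OF Z Y]
      vf_apply_lie_bracket[OF Y Z h] divergence_lie_bracket[OF Y Z]
    by (simp add: algebra_simps)
qed

subsection \<open>Integration by parts\<close>

text \<open>Cutting \<open>g\<close> down to \<open>D\<close> does not change it, because it
  vanishes off \<open>K\<close>; integrability on one box around \<open>K\<close> is therefore
  enough.\<close>

lemma integrable_on_compact_support:
  fixes g :: "'a::euclidean_space \<Rightarrow> real"
  assumes "continuous_on UNIV g" "bounded K" "K \<subseteq> D" "\<And>x. x \<notin> K \<Longrightarrow> g x = 0"
  shows "g integrable_on D"
proof -
  obtain a where a: "K \<subseteq> cbox (-a) a"
    using bounded_subset_cbox_symmetric[OF assms(2)] .
  have "g integrable_on cbox (-a) a"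
    by (rule integrable_continuous) (rule continuous_on_subset[OF assms(1)], simp)
  then have "g integrable_on UNIV"
    by (rule integrable_on_superset) (use a assms(4) in auto)
  then have "(\<lambda>x. if x \<in> D then g x else 0) integrable_on UNIV"
    by (rule integrable_eq) (use assms(3,4) in auto)
  then show ?thesis by (simp only: integrable_restrict_UNIV)
qed

text \<open>The integral of \<open>g (x + t *\<^sub>R v)\<close> does not depend on \<open>t\<close>; differentiate at \<open>t = 0\<close>.\<close>

lemma has_integral_dder_compact_support:
  fixes g :: "'a::euclidean_space \<Rightarrow> real"
  assumes d: "\<And>x. (g has_derivative g' x) (at x)"
    and c: "continuous_on UNIV (\<lambda>x. g' x v)"
    and K: "compact K" "\<And>x. x \<notin> K \<Longrightarrow> g x = 0"
  shows "((\<lambda>x. g' x v) has_integral 0) UNIV"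
proof -
  have contg: "continuous_on S g" for S
    using d has_derivative_continuous continuous_at_imp_continuous_on by blast
  have "bounded K" using K(1) by (rule compact_imp_bounded)
  then obtain r where r: "\<And>x. x \<in> K \<Longrightarrow> norm x \<le> r" by (auto simp: bounded_iff)
  \<comment> \<open>The box leaves a margin of \<open>norm v\<close> around \<open>K\<close>, so the
    support of each translate with \<open>\<bar>t\<bar> \<le> 1\<close> stays inside it and the
    domain of integration need not move.\<close>
  obtain a where a: "cball (0::'a) (r + norm v) \<subseteq> cbox (-a) a"
    using bounded_subset_cbox_symmetric[OF bounded_cball] .
  have out: "g (x + t *\<^sub>R v) = 0" if "x \<notin> cbox (-a) a" "\<bar>t\<bar> \<le> 1" for x t
  proof (rule K(2), rule notI)
    assume "x + t *\<^sub>R v \<in> K"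
    from r[OF this] have "norm x \<le> r + norm (t *\<^sub>R v)"
      using norm_triangle_ineq4[of "x + t *\<^sub>R v" "t *\<^sub>R v"] by simp
    also have "norm (t *\<^sub>R v) \<le> norm v"
      using that(2) by (simp add: mult_left_le_one_le)
    finally show False using a that(1) by auto
  qed
  define I where "I = integral (cbox (-a) a) g"
  have I: "(g has_integral I) (cbox (-a) a)"
    unfolding I_def using integrable_continuous[OF contg] by (rule integrable_integral)
  have const: "integral (cbox (-a) a) (\<lambda>x. g (x + t *\<^sub>R v)) = I" if "\<bar>t\<bar> \<le> 1" for t
  proof -
    have "((\<lambda>x. g (x + t *\<^sub>R v)) has_integral I) UNIV"
    proof (rule has_integral_on_superset[OF has_integral_shift_cbox[OF I, of "t *\<^sub>R v"]])
      fix x assume "x \<notin> cbox (- a - t *\<^sub>R v) (a - t *\<^sub>R v)"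
      then have "x + t *\<^sub>R v \<notin> cbox (-a) a"
        by (auto simp: mem_box algebra_simps)
      from out[OF this, of 0] show "g (x + t *\<^sub>R v) = 0" by simp
    qed simp
    then have "((\<lambda>x. if x \<in> cbox (-a) a then g (x + t *\<^sub>R v) else 0) has_integral I) UNIV"
      by (rule has_integral_eq[rotated]) (use out[OF _ that] in auto)
    then show ?thesis
      by (simp only: has_integral_restrict_UNIV integral_unique)
  qed
  have "((\<lambda>t. integral (cbox (-a) a) (\<lambda>x. g (x + t *\<^sub>R v))) has_vector_derivative
      integral (cbox (-a) a) (\<lambda>x. g' (x + 0 *\<^sub>R v) v)) (at 0 within UNIV)"
  proof (rule leibniz_rule_vector_derivative)
    fix t x
    have "((\<lambda>t. g (x + t *\<^sub>R v)) has_derivative (\<lambda>s. g' (x + t *\<^sub>R v) (s *\<^sub>R v))) (at t)"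
      by (rule has_derivative_compose[OF _ d]) (auto intro!: derivative_eq_intros)
    then show "((\<lambda>t. g (x + t *\<^sub>R v)) has_vector_derivative g' (x + t *\<^sub>R v) v) (at t within UNIV)"
      using has_derivative_linear[OF d, of "x + t *\<^sub>R v"]
      by (simp add: has_vector_derivative_def linear_scale)
    show "(\<lambda>x. g (x + t *\<^sub>R v)) integrable_on cbox (-a) a"
      by (rule integrable_continuous) (rule continuous_on_compose2[OF contg[of UNIV]], auto intro!: continuous_intros)
    show "continuous_on (UNIV \<times> cbox (-a) a) (\<lambda>(t, x). g' (x + t *\<^sub>R v) v)"
      unfolding split_beta
      by (rule continuous_on_compose2[OF c], auto intro!: continuous_intros)
  qed auto
  \<comment> \<open>Near \<open>t = 0\<close> the integral is constant, so its derivative, computed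
    above under the integral sign, must vanish.\<close>
  moreover have "((\<lambda>t. integral (cbox (-a) a) (\<lambda>x. g (x + t *\<^sub>R v))) has_vector_derivative 0) (at 0)"
    by (rule has_vector_derivative_transform_within_open[of "\<lambda>t. I" _ _ "{-1<..<1}"])
      (use const in \<open>auto intro!: derivative_eq_intros\<close>)
  ultimately have 0: "integral (cbox (-a) a) (\<lambda>x. g' x v) = 0"
    by (simp add: vector_derivative_unique_at)
  have "(\<lambda>x. g' x v) integrable_on cbox (-a) a"
    by (rule integrable_continuous) (rule continuous_on_subset[OF c], simp)
  then have h: "((\<lambda>x. g' x v) has_integral 0) (cbox (-a) a)"
    using 0 by (metis integrable_integral)
  \<comment> \<open>\<open>g\<close> is zero on the open complement of the box, hence so is its
    derivative; this extends the integral from the box to the whole space.\<close>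
  have supp: "g' x v = 0" if "x \<notin> cbox (-a) a" for x
  proof -
    have "open (- cbox (-a) a)" using closed_cbox by (rule open_Compl)
    then have "(g has_derivative (\<lambda>v. 0)) (at x)"
      by (rule has_derivative_transform_within_open[OF has_derivative_const]) (use that out[of _ 0] in auto)
    then have "g' x = (\<lambda>v. 0)" using d has_derivative_unique by blast
    then show ?thesis by simp
  qed
  show ?thesis by (rule has_integral_on_superset[OF h supp]) auto
qed

section \<open>Picone's inequality for compactly supported C^1 functions\<close>

lemma C1_0_E:
  assumes "f \<in> C1_0 D"
  obtains K where "compact K" "K \<subseteq> D" "\<And>x. x \<notin> K \<Longrightarrow> f x = 0"
    "\<And>x v. x \<notin> K \<Longrightarrow> dder v f x = 0"
    "\<And>x. (f has_derivative (\<lambda>v. dder v f x)) (at x)" "\<And>v. continuous_on UNIV (dder v f)"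
    "continuous_on UNIV f"
proof -
  define K where "K = closure {x. f x \<noteq> 0}"
  from assms obtain f' where f': "\<And>x. (f has_derivative blinfun_apply (f' x)) (at x)"
      "continuous_on UNIV f'" and K: "compact K" "K \<subseteq> D"
    unfolding C1_0_def K_def by auto
  have e: "dder v f x = blinfun_apply (f' x) v" for v x
    by (rule dder_eq[OF f'(1)])
  have e': "dder v f = (\<lambda>x. blinfun_apply (f' x) v)" for v
    using e by auto
  have z: "f x = 0" if "x \<notin> K" for x
    using that closure_subset[of "{x. f x \<noteq> 0}"] unfolding K_def by blast
  show thesis
  proof (rule that[OF K])
    show "f x = 0" if "x \<notin> K" for x by (rule z[OF that])
    show "dder v f x = 0" if "x \<notin> K" for x v
    proof (rule dder_eq)
      have "open (- K)" unfolding K_def by (intro open_Compl closed_closure)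
      then show "(f has_derivative (\<lambda>v. 0)) (at x)"
        by (rule has_derivative_transform_within_open[OF has_derivative_const]) (use that z in auto)
    qed
    show "(f has_derivative (\<lambda>v. dder v f x)) (at x)" for x
      using f'(1) by (simp add: e)
    show "continuous_on UNIV (dder v f)" for v
      unfolding e' using f'(2) by (intro continuous_intros)
    show "continuous_on UNIV f"
      using f'(1) has_derivative_continuous continuous_at_imp_continuous_on by blast
  qed
qed

text \<open>The integrand is the divergence of the field \<open>f^2 p X\<close>, which has compact
  support inside \<open>D\<close>, so no boundary term appears.\<close>

lemma integration_by_parts_square:
  assumes f: "f \<in> C1_0 D" and X: "smooth_field X" and p: "smooth p"
  shows "((\<lambda>x. 2 * f x * p x * vf_apply X f x - (f x)\<^sup>2 * vf_adjoint X p x) has_integral 0) D"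
proof -
  from f obtain K where K: "compact K" "K \<subseteq> D" "\<And>x. x \<notin> K \<Longrightarrow> f x = 0"
    and d: "\<And>x. (f has_derivative (\<lambda>v. dder v f x)) (at x)"
    and c: "\<And>v. continuous_on UNIV (dder v f)" "continuous_on UNIV f"
    by (rule C1_0_E) auto
  \<comment> \<open>One coordinate of the divergence, over the whole space.\<close>
  have part: "((\<lambda>x. (f x)\<^sup>2 * pd k (\<lambda>y. p y * X y $ k) x
      + 2 * f x * pd k f x * (p x * X x $ k)) has_integral 0) UNIV" for k
  proof -
    have s: "smooth (\<lambda>y. p y * X y $ k)" using X p by (intro smooth_intros)
    have "((\<lambda>x. (f x)\<^sup>2 * q x) has_derivative
      (\<lambda>v. (f x)\<^sup>2 * dder v q x + 2 * f x * dder v f x * q x)) (at x)" if "smooth q" for q x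
      using smooth_has_derivative[OF that] d by (auto intro!: derivative_eq_intros)
    from this[OF s] show ?thesis
      by (rule has_integral_dder_compact_support[where K = K])
        (use K in \<open>auto intro!: continuous_intros c smooth_continuous_on[OF smooth_dder[OF s]]
            smooth_continuous_on[OF p] smooth_continuous_on[OF smooth_fieldD[OF X]]\<close>)
  qed
  have "((\<lambda>x. \<Sum>k\<in>UNIV. (f x)\<^sup>2 * pd k (\<lambda>y. p y * X y $ k) x
      + 2 * f x * pd k f x * (p x * X x $ k)) has_integral (\<Sum>k\<in>(UNIV::'a set). 0)) UNIV"
    by (rule has_integral_sum) (use part in auto)
  moreover have "(\<Sum>k\<in>UNIV. (f x)\<^sup>2 * pd k (\<lambda>y. p y * X y $ k) x
      + 2 * f x * pd k f x * (p x * X x $ k))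
      = (if x \<in> D then 2 * f x * p x * vf_apply X f x - (f x)\<^sup>2 * vf_adjoint X p x else 0)" for x
  proof -
    have s: "smooth_field (\<lambda>y. p y *\<^sub>R X y)"
      unfolding smooth_field_def using X p by (auto intro: smooth_intros)
    have "vf_adjoint X p x = - (\<Sum>k\<in>UNIV. pd k (\<lambda>y. p y * X y $ k) x)"
      unfolding vf_adjoint_def divergence_smooth_field[OF s] by simp
    moreover have "vf_apply X f x = (\<Sum>k\<in>UNIV. X x $ k * pd k f x)"
      using d differentiable_def by (intro vf_apply_eq) blast
    moreover have "f x = 0" if "x \<notin> D" using that K by blast
    ultimately show ?thesis
      by (simp add: sum.distrib sum_distrib_left mult_ac)
  qed
  ultimately show ?thesis
    by (simp add: has_integral_restrict_UNIV)
qed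

text \<open>A uniform gap \<open>c\<close> between \<open>V\<close> and the Picone weight becomes a
  lower bound on the energy. The energy density is compared pointwise with \<open>c * f^2\<close>
  plus terms of zero integral.\<close>

lemma energy_lower_bound:
  fixes A :: "nat \<Rightarrow> real^'n::finite \<Rightarrow> real^'n"
  assumes f: "f \<in> C1_0 D" and A: "\<And>j. j < m \<Longrightarrow> smooth_field (A j)"
    and p: "\<And>j. j < m \<Longrightarrow> smooth (p j)" and V: "smooth V"
    and le: "\<And>x. x \<in> D \<Longrightarrow> V x + c \<le> (\<Sum>j<m. vf_adjoint (A j) (p j) x - (p j x)\<^sup>2)"
  shows "c * integral D (\<lambda>x. (f x)\<^sup>2) \<le> integral D (\<lambda>x. grad_X_sq A m f x - V x * (f x)\<^sup>2)"
proof -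
  from f obtain K where K: "compact K" "K \<subseteq> D" "\<And>x. x \<notin> K \<Longrightarrow> f x = 0"
      "\<And>x v. x \<notin> K \<Longrightarrow> dder v f x = 0"
    and d: "\<And>x. (f has_derivative (\<lambda>v. dder v f x)) (at x)"
    and cf: "\<And>v. continuous_on UNIV (dder v f)" "continuous_on UNIV f"
    by (rule C1_0_E) auto
  have app: "vf_apply (A j) f = (\<lambda>x. \<Sum>k\<in>UNIV. A j x $ k * pd k f x)" for j
    using d differentiable_def by (intro ext vf_apply_eq) blast
  have capp: "continuous_on UNIV (vf_apply (A j) f)" if "j < m" for j
    unfolding app using A[OF that]
    by (intro continuous_intros cf smooth_continuous_on smooth_fieldD)
  have app0: "vf_apply (A j) f x = 0" if "x \<notin> K" for j x
    by (simp add: vf_apply_def flip: dder_def) (rule K(4)[OF that])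
  have i1: "(\<lambda>x. grad_X_sq A m f x - V x * (f x)\<^sup>2) integrable_on D"
    unfolding grad_X_sq_def
    by (rule integrable_on_compact_support[OF _ compact_imp_bounded[OF K(1)] K(2)])
      (auto intro!: continuous_intros capp cf smooth_continuous_on[OF V] simp: app0 K(3))
  have i2: "(\<lambda>x. c * (f x)\<^sup>2) integrable_on D"
    by (rule integrable_on_compact_support[OF _ compact_imp_bounded[OF K(1)] K(2)])
      (auto intro!: continuous_intros cf simp: K(3))
  have h: "((\<lambda>x. \<Sum>j<m. 2 * f x * p j x * vf_apply (A j) f x - (f x)\<^sup>2 * vf_adjoint (A j) (p j) x)
      has_integral (\<Sum>j<m. 0)) D"
    by (rule has_integral_sum) (use integration_by_parts_square[OF f A p] in auto)
  have "((\<lambda>x. c * (f x)\<^sup>2 + (\<Sum>j<m. 2 * f x * p j x * vf_apply (A j) f x - (f x)\<^sup>2 * vf_adjoint (A j) (p j) x))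
      has_integral (integral D (\<lambda>x. c * (f x)\<^sup>2) + (\<Sum>j<m. 0))) D"
    by (rule has_integral_add[OF integrable_integral[OF i2] h])
  then have "integral D (\<lambda>x. c * (f x)\<^sup>2) + (\<Sum>j<m. 0) \<le> integral D (\<lambda>x. grad_X_sq A m f x - V x * (f x)\<^sup>2)"
  proof (rule has_integral_le[OF _ integrable_integral[OF i1]])
    fix x assume x: "x \<in> D"
    have "(V x + c) * (f x)\<^sup>2 \<le> (\<Sum>j<m. vf_adjoint (A j) (p j) x - (p j x)\<^sup>2) * (f x)\<^sup>2"
      by (intro mult_right_mono le x) auto
    also have "\<dots> \<le> (\<Sum>j<m. (vf_apply (A j) f x)\<^sup>2
        - (2 * f x * p j x * vf_apply (A j) f x - (f x)\<^sup>2 * vf_adjoint (A j) (p j) x))"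
      unfolding sum_distrib_right
    proof (rule sum_mono)
      fix j
      \<comment> \<open>Completing the square, where the mixed term is supplied by the expression of
        zero integral.\<close>
      have "0 \<le> (vf_apply (A j) f x - p j x * f x)\<^sup>2" by simp
      then show "(vf_adjoint (A j) (p j) x - (p j x)\<^sup>2) * (f x)\<^sup>2 \<le> (vf_apply (A j) f x)\<^sup>2
        - (2 * f x * p j x * vf_apply (A j) f x - (f x)\<^sup>2 * vf_adjoint (A j) (p j) x)"
        by (simp add: power2_eq_square algebra_simps)
    qed
    finally show "c * (f x)\<^sup>2 + (\<Sum>j<m. 2 * f x * p j x * vf_apply (A j) f x - (f x)\<^sup>2 * vf_adjoint (A j) (p j) x)
        \<le> grad_X_sq A m f x - V x * (f x)\<^sup>2"
      by (simp add: sum_subtractf sum.distrib grad_X_sq_def algebra_simps)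
  qed
  then show ?thesis by simp
qed

subsection \<open>The range of the adjoints of Hoermander fields\<close>

lemma vf_adjoint_add:
  assumes "smooth_field X" "smooth f" "smooth g"
  shows "vf_adjoint X (\<lambda>x. f x + g x) x = vf_adjoint X f x + vf_adjoint X g x"
  using assms by (simp add: vf_adjoint_eq vf_apply_add smooth_intros algebra_simps)

lemma vf_adjoint_minus:
  assumes "smooth_field X" "smooth f"
  shows "vf_adjoint X (\<lambda>x. - f x) x = - vf_adjoint X f x"
  using assms by (simp add: vf_adjoint_eq vf_apply_minus smooth_intros algebra_simps)

text \<open>Multiplication by \<open>g\<close> commutes with the adjoint up to the term
  \<open>- f * X g\<close>. This term yields the large constant in the exponential construction and
  the cancellations in the final weight.\<close>

lemma vf_adjoint_mult:
  assumes "smooth_field X" "smooth f" "smooth g"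
  shows "vf_adjoint X (\<lambda>x. f x * g x) x = g x * vf_adjoint X f x - f x * vf_apply X g x"
  using assms by (simp add: vf_adjoint_eq vf_apply_mult smooth_intros algebra_simps)

lemma vf_adjoint_zero: "smooth_field X \<Longrightarrow> vf_adjoint X (\<lambda>x. 0) x = 0"
  by (simp add: vf_adjoint_eq smooth_const vf_apply_def)

text \<open>The range of the formal adjoint of the map sending \<open>f\<close> to all the
  \<open>X_j f\<close>; up to sign, the divergences of smooth combinations of the fields
  \<open>A j\<close>.\<close>

definition adjoint_range :: "(nat \<Rightarrow> 'n::finite vfield) \<Rightarrow> nat \<Rightarrow> (real^'n \<Rightarrow> real) set" where
  "adjoint_range A m = {\<lambda>x. \<Sum>j<m. vf_adjoint (A j) (H j) x | H. \<forall>j. smooth (H j)}"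

lemma adjoint_range_add:
  assumes "\<And>j. j < m \<Longrightarrow> smooth_field (A j)" "f \<in> adjoint_range A m" "g \<in> adjoint_range A m"
  shows "(\<lambda>x. f x + g x) \<in> adjoint_range A m"
proof -
  from assms obtain F G where F: "f = (\<lambda>x. \<Sum>j<m. vf_adjoint (A j) (F j) x)" "\<And>j. smooth (F j)"
    and G: "g = (\<lambda>x. \<Sum>j<m. vf_adjoint (A j) (G j) x)" "\<And>j. smooth (G j)"
    unfolding adjoint_range_def by auto
  have "(\<lambda>x. f x + g x) = (\<lambda>x. \<Sum>j<m. vf_adjoint (A j) (\<lambda>y. F j y + G j y) x)"
    using assms(1) F G by (auto simp: vf_adjoint_add sum.distrib)
  moreover have "\<forall>j. smooth (\<lambda>y. F j y + G j y)" using F G by (auto intro: smooth_intros)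
  ultimately show ?thesis
    unfolding adjoint_range_def by (auto intro!: exI[of _ "\<lambda>j y. F j y + G j y"])
qed

lemma adjoint_range_zero:
  assumes "\<And>j. j < m \<Longrightarrow> smooth_field (A j)"
  shows "(\<lambda>x. 0) \<in> adjoint_range A m"
proof -
  have "(\<lambda>x. 0) = (\<lambda>x. \<Sum>j<m. vf_adjoint (A j) (\<lambda>y. 0) x)"
    using assms by (auto simp: vf_adjoint_zero)
  moreover have "\<forall>j. smooth (\<lambda>y::real^'a. 0::real)" by (auto intro: smooth_intros)
  ultimately show ?thesis
    unfolding adjoint_range_def by (auto intro!: exI[of _ "\<lambda>j y. 0"])
qed

lemma adjoint_range_sum:
  assumes "\<And>j. j < m \<Longrightarrow> smooth_field (A j)" "\<And>i. i \<in> I \<Longrightarrow> f i \<in> adjoint_range A m"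
  shows "(\<lambda>x. \<Sum>i\<in>I. f i x) \<in> adjoint_range A m"
  using assms(2)
  by (induction I rule: infinite_finite_induct)
    (auto intro: adjoint_range_zero adjoint_range_add assms(1))

text \<open>In the bracket identity each term is an outer adjoint applied to a smooth function, so
  the induction hypothesis for the outer field, stated for all smooth \<open>h\<close>, puts both
  terms in the range.\<close>

lemma commutator_adjoint_range:
  assumes "commutator A m l Z" and A: "\<And>j. j < m \<Longrightarrow> smooth_field (A j)"
  shows "smooth_field Z \<and> (\<forall>h. smooth h \<longrightarrow> vf_adjoint Z h \<in> adjoint_range A m)"
  using assms(1)
proof (induction rule: commutator.induct)
  case (gen j)
  have "vf_adjoint (A j) h \<in> adjoint_range A m" if h: "smooth h" for h
  proof -
    define H where "H = (\<lambda>i. if i = j then h else (\<lambda>y. 0))"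
    have "vf_adjoint (A j) h x = (\<Sum>i<m. vf_adjoint (A i) (H i) x)" for x
    proof -
      have "(\<Sum>i<m. vf_adjoint (A i) (H i) x) = (\<Sum>i<m. if i = j then vf_adjoint (A j) h x else 0)"
        by (rule sum.cong) (auto simp: H_def vf_adjoint_zero A)
      then show ?thesis using gen by simp
    qed
    moreover have "\<forall>i. smooth (H i)" using h by (auto simp: H_def intro: smooth_intros)
    ultimately show ?thesis unfolding adjoint_range_def by blast
  qed
  then show ?case using A gen by blast
next
  case (brk a Y b Z)
  have Y: "smooth_field Y" and Z: "smooth_field Z" using brk by auto
  have "vf_adjoint (lie_bracket Y Z) h \<in> adjoint_range A m" if h: "smooth h" for h
  proof -
    have sY: "smooth (vf_adjoint Y h)" and sZ: "smooth (vf_adjoint Z h)"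
      using Y Z h by (auto intro: smooth_intros)
    \<comment> \<open>The minus sign is moved into the argument, so that closure under addition
      suffices.\<close>
    have "vf_adjoint (lie_bracket Y Z) h
        = (\<lambda>x. vf_adjoint Z (vf_adjoint Y h) x + vf_adjoint Y (\<lambda>y. - vf_adjoint Z h y) x)"
      using vf_adjoint_lie_bracket[OF Y Z h] vf_adjoint_minus[OF Y sZ] by auto
    then show ?thesis
      using brk.IH sY smooth_minus[OF sZ] by (auto intro: adjoint_range_add A)
  qed
  then show ?case using smooth_field_lie_bracket[OF Y Z] by blast
qed

section \<open>Commutators of bounded length and a positive element of the adjoint range\<close>

lemma commutator_length_pos: "commutator A m l Z \<Longrightarrow> l \<ge> 1"
  by (induction rule: commutator.induct) auto

text \<open>Both factors of a bracket have length at least 1, so a bracket of length at most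
  \<open>Suc r\<close> has factors of length at most \<open>r\<close>, and these are finite in
  number by induction.\<close>

lemma finite_commutators: "finite {Z. \<exists>l\<le>r. commutator A m l Z}"
proof (induction r)
  case 0
  have "{Z. \<exists>l\<le>0. commutator A m l Z} = {}"
    using commutator_length_pos by fastforce
  then show ?case by simp
next
  case (Suc r)
  let ?C = "{Z. \<exists>l\<le>r. commutator A m l Z}"
  have "{Z. \<exists>l\<le>Suc r. commutator A m l Z} \<subseteq> A ` {..<m} \<union> (\<lambda>(Y, Z). lie_bracket Y Z) ` (?C \<times> ?C)"
  proof
    fix W assume "W \<in> {Z. \<exists>l\<le>Suc r. commutator A m l Z}"
    then obtain l where l: "l \<le> Suc r" "commutator A m l W" by blast
    from l(2) show "W \<in> A ` {..<m} \<union> (\<lambda>(Y, Z). lie_bracket Y Z) ` (?C \<times> ?C)"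
    proof cases
      case (gen j)
      then show ?thesis by auto
    next
      case (brk a Y b Z)
      then have "a \<le> r" "b \<le> r"
        using l(1) commutator_length_pos[of A m a Y] commutator_length_pos[of A m b Z] by auto
      with brk show ?thesis by blast
    qed
  qed
  then show ?case by (rule finite_subset) (use Suc in auto)
qed

lemma vf_apply_exp_coord:
  "vf_apply X (\<lambda>x. exp (K * x $ k)) x = K * X x $ k * exp (K * x $ k)"
proof -
  have "((\<lambda>x. exp (K * x $ k)) has_derivative (\<lambda>v. K * v $ k * exp (K * x $ k))) (at x)"
    by (auto intro!: derivative_eq_intros bounded_linear.has_derivative[OF bounded_linear_vec_nth])
  from dder_eq[OF this] show ?thesis by (simp add: vf_apply_def dder_def)
qed

text \<open>For a large constant \<open>K\<close> the function
  \<open>\<Sum>Z. Z\<^sup>* (- Z\<^sub>k exp (K x\<^sub>k)) = exp (K x\<^sub>k) \<Sum>Z. (K Z\<^sub>k\<^sup>2 + div (Z\<^sub>k Z))\<close>, summed over the commutators, is positive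
  on a compact set, because the commutators span.\<close>

lemma hoermander_adjoint_range_positive:
  fixes A :: "nat \<Rightarrow> real^'n::finite \<Rightarrow> real^'n"
  assumes hoe: "hoermander A m" and S: "compact S"
  shows "\<exists>s\<in>adjoint_range A m. \<forall>x\<in>S. s x > 0"
proof -
  have A: "smooth_field (A j)" if "j < m" for j
    using hoe that smooth_imp_smooth_field unfolding hoermander_def by blast
  show ?thesis
  proof (cases "S = {}")
    case True
    then show ?thesis using adjoint_range_zero[of m A] A by blast
  next
    case False
    obtain r where r: "\<And>x. span {Z x | Z l. l \<le> r \<and> commutator A m l Z} = UNIV"
      using hoe unfolding hoermander_def by blast
    define C where "C = {Z. \<exists>l\<le>r. commutator A m l Z}"
    have C: "finite C" unfolding C_def by (rule finite_commutators)
    have sC: "smooth_field Z" if "Z \<in> C" for Z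
      using that commutator_adjoint_range[of A m _ Z] A unfolding C_def by blast
    \<comment> \<open>A single coordinate, chosen arbitrarily, is enough.\<close>
    fix k :: 'n
    define q where "q x = (\<Sum>Z\<in>C. (Z x $ k)\<^sup>2)" for x
    define P where "P x = (\<Sum>Z\<in>C. vf_apply Z (\<lambda>y. Z y $ k) x + Z x $ k * divergence Z x)" for x
    have sq: "smooth q" unfolding q_def[abs_def] using sC by (intro smooth_intros)
    have sP: "smooth P" unfolding P_def[abs_def] using sC by (intro smooth_intros)
    \<comment> \<open>If every commutator had zero \<open>k\<close>-th component at
      \<open>x\<close>, their span would lie in a hyperplane missing
      \<open>axis k 1\<close>.\<close>
    have qpos: "q x > 0" for x
    proof (rule ccontr)
      assume "\<not> q x > 0"
      moreover have "q x \<ge> 0" unfolding q_def by (intro sum_nonneg) auto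
      ultimately have "q x = 0" by linarith
      then have z: "Z x $ k = 0" if "Z \<in> C" for Z
        using that C unfolding q_def by (simp add: sum_nonneg_eq_0_iff)
      have "span {Z x | Z l. l \<le> r \<and> commutator A m l Z} \<subseteq> {v. v $ k = 0}"
        by (rule span_minimal) (use z in \<open>auto simp: C_def subspace_def\<close>)
      then have "axis k (1::real) \<in> {v. v $ k = 0}" unfolding r by blast
      then show False by simp
    qed
    obtain x0 where x0: "x0 \<in> S" "\<And>x. x \<in> S \<Longrightarrow> q x0 \<le> q x"
      using continuous_attains_inf[OF S False smooth_continuous_on[OF sq]] by blast
    obtain x1 where x1: "x1 \<in> S" "\<And>x. x \<in> S \<Longrightarrow> P x1 \<le> P x"
      using continuous_attains_inf[OF S False smooth_continuous_on[OF sP]] by blast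
    \<comment> \<open>On \<open>S\<close> this makes \<open>K * q\<close> at least
      \<open>\<bar>P x1\<bar> + 1\<close>, which outweighs the minimum \<open>P x1\<close> of
      \<open>P\<close>.\<close>
    define K where "K = (\<bar>P x1\<bar> + 1) / q x0"
    define w where "w Z x = - (Z x $ k) * exp (K * x $ k)" for Z :: "real^'n \<Rightarrow> real^'n" and x
    have sw: "smooth (w Z)" if "Z \<in> C" for Z
      unfolding w_def[abs_def] using sC[OF that] by (intro smooth_intros)
    define s where "s x = (\<Sum>Z\<in>C. vf_adjoint Z (w Z) x)" for x
    have "s \<in> adjoint_range A m"
      unfolding s_def[abs_def]
    proof (rule adjoint_range_sum[OF A])
      fix Z assume Z: "Z \<in> C"
      then obtain l where "commutator A m l Z" unfolding C_def by blast
      with sw[OF Z] show "vf_adjoint Z (w Z) \<in> adjoint_range A m"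
        using commutator_adjoint_range[of A m l Z] A by blast
    qed auto
    moreover have "s x > 0" if x: "x \<in> S" for x
    proof -
      have "vf_adjoint Z (w Z) x = exp (K * x $ k) *
          (K * (Z x $ k)\<^sup>2 + (vf_apply Z (\<lambda>y. Z y $ k) x + Z x $ k * divergence Z x))" if Z: "Z \<in> C" for Z
      proof -
        have 1: "smooth (\<lambda>x. Z x $ k)" "smooth (\<lambda>x. - (Z x $ k))" "smooth (\<lambda>x::real^'n. exp (K * x $ k))"
          using sC[OF Z] by (auto intro!: smooth_intros)
        have "vf_adjoint Z (w Z) x = exp (K * x $ k) * vf_adjoint Z (\<lambda>x. - (Z x $ k)) x
            - (- (Z x $ k)) * vf_apply Z (\<lambda>x. exp (K * x $ k)) x"
          unfolding w_def[abs_def] by (rule vf_adjoint_mult[OF sC[OF Z] 1(2,3)])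
        also have "vf_adjoint Z (\<lambda>x. - (Z x $ k)) x
            = vf_apply Z (\<lambda>y. Z y $ k) x + Z x $ k * divergence Z x"
          using vf_adjoint_minus[OF sC[OF Z] 1(1)] vf_adjoint_eq[OF sC[OF Z] 1(1)] by simp
        finally show ?thesis
          by (simp add: vf_apply_exp_coord power2_eq_square algebra_simps)
      qed
      then have "s x = exp (K * x $ k) * (K * q x + P x)"
        unfolding s_def q_def P_def by (simp add: sum_distrib_left sum.distrib distrib_left)
      moreover have "K * q x0 \<le> K * q x"
        using x0(2)[OF x] qpos[of x0] by (intro mult_left_mono) (auto simp: K_def)
      moreover have "K * q x0 = \<bar>P x1\<bar> + 1" using qpos[of x0] by (simp add: K_def)
      moreover have "P x1 \<le> P x" by (rule x1(2)[OF x])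
      ultimately show ?thesis by simp
    qed
    ultimately show ?thesis by blast
  qed
qed

subsection \<open>Positivity of the first eigenvalue\<close>

theorem theorem1p2:
  fixes A :: "nat \<Rightarrow> real^'n::finite \<Rightarrow> real^'n" and m :: nat
    and V u :: "real^'n \<Rightarrow> real" and D :: "(real^'n) set"
  assumes "hoermander A m"
    and "smooth V"
    and "smooth u" and "\<forall>x. u x > 0"
    and "\<forall>x. hoerm_lap A m u x - V x * u x \<ge> 0"
    and "regular_domain A m D"
  shows "lambda1 A m V D > 0"
proof -
  have A: "smooth_field (A j)" if "j < m" for j
    using assms(1) that smooth_imp_smooth_field unfolding hoermander_def by blast
  have S: "compact (closure D)" "closure D \<noteq> {}"
    using assms(6) unfolding regular_domain_def by auto
  obtain s where s: "s \<in> adjoint_range A m" "\<And>x. x \<in> closure D \<Longrightarrow> s x > 0"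
    using hoermander_adjoint_range_positive[OF assms(1) S(1)] by blast
  obtain H where H: "s = (\<lambda>x. \<Sum>j<m. vf_adjoint (A j) (H j) x)" "\<And>j. smooth (H j)"
    using s(1) unfolding adjoint_range_def by blast
  have ss: "smooth s" unfolding H using A H by (intro smooth_intros) auto
  define iu where "iu x = inverse (u x)" for x
  have un: "u x \<noteq> 0" for x using assms(4) by (metis less_irrefl)
  have iupos: "iu x > 0" for x unfolding iu_def using assms(4) by simp
  have siu: "smooth iu" unfolding iu_def[abs_def] by (intro smooth_intros assms(3) un)
  have Xiu: "vf_apply X iu x = - (iu x)\<^sup>2 * vf_apply X u x" for X x
  proof -
    have "(iu has_derivative (\<lambda>v. - (iu x)\<^sup>2 * dder v u x)) (at x)"
      unfolding iu_def[abs_def]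
      by (auto intro!: derivative_eq_intros smooth_has_derivative assms(3) simp: un power2_eq_square)
    from dder_eq[OF this] show ?thesis by (simp add: vf_apply_def dder_def)
  qed
  \<comment> \<open>\<open>g\<close> and \<open>b\<close> are the coefficients of \<open>e\<close>
    and \<open>- e^2\<close> in the perturbed weight; only the sign of the first is
    favourable.\<close>
  define g where "g x = (iu x)\<^sup>2 * s x" for x
  define b where "b x = (iu x)^4 * (\<Sum>j<m. (H j x)\<^sup>2)" for x
  have "continuous_on (closure D) g" "continuous_on (closure D) b"
    unfolding g_def[abs_def] b_def[abs_def]
    by (intro smooth_continuous_on smooth_intros siu ss H)+
  then obtain x0 x1 where x0: "x0 \<in> closure D" "\<And>x. x \<in> closure D \<Longrightarrow> g x0 \<le> g x"
    and x1: "x1 \<in> closure D" "\<And>x. x \<in> closure D \<Longrightarrow> b x \<le> b x1"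
    using continuous_attains_inf[OF S, of g] continuous_attains_sup[OF S, of b] by blast
  have g0: "g x0 > 0" unfolding g_def using s(2)[OF x0(1)] iupos[of x0] by simp
  have b1: "b x1 \<ge> 0" unfolding b_def by (intro mult_nonneg_nonneg sum_nonneg) auto
  \<comment> \<open>Chosen so that \<open>e * (b x1 + 1) = g x0 / 2\<close>: the quadratic loss
    costs at most half of the linear gain, and \<open>c\<close> is the other half. The summand 1
    keeps the denominator positive when \<open>b x1 = 0\<close>.\<close>
  define e where "e = g x0 / (2 * (b x1 + 1))"
  define c where "c = e * (g x0 / 2)"
  have e: "e > 0" using g0 b1 by (simp add: e_def)
  have c: "c > 0" using g0 e by (simp add: c_def)
  \<comment> \<open>The logarithmic derivative of \<open>u\<close>, perturbed. With the factor
    \<open>1/u^2\<close> the cross term of \<open>(p j)^2\<close> cancels the derivative that falls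
    on this factor.\<close>
  define p where "p j x = vf_apply (A j) u x * iu x + (e * H j x) * (iu x * iu x)" for j x
  have sp: "smooth (p j)" if "j < m" for j
    unfolding p_def[abs_def] by (intro smooth_intros A that assms(3) siu H)
  have key: "V x + c \<le> (\<Sum>j<m. vf_adjoint (A j) (p j) x - (p j x)\<^sup>2)" if x: "x \<in> closure D" for x
  proof -
    \<comment> \<open>The squares of \<open>X_j u / u\<close> and the terms containing
      \<open>H j x * vf_apply (A j) u x\<close> drop out, so no first derivative of \<open>u\<close>
      survives except inside its second-order term.\<close>
    have "vf_adjoint (A j) (p j) x - (p j x)\<^sup>2 = iu x * vf_adjoint (A j) (vf_apply (A j) u) x
        + e * ((iu x)\<^sup>2 * vf_adjoint (A j) (H j) x) - e\<^sup>2 * ((iu x)^4 * (H j x)\<^sup>2)" if j: "j < m" for j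
    proof -
      note [simp] = A[OF j] siu H(2) assms(3)
      have "vf_adjoint (A j) (p j) x
        = vf_adjoint (A j) (\<lambda>x. vf_apply (A j) u x * iu x) x
          + vf_adjoint (A j) (\<lambda>x. (e * H j x) * (iu x * iu x)) x"
        unfolding p_def[abs_def] by (intro vf_adjoint_add smooth_intros) simp_all
      also have "vf_adjoint (A j) (\<lambda>x. vf_apply (A j) u x * iu x) x
        = iu x * vf_adjoint (A j) (vf_apply (A j) u) x - vf_apply (A j) u x * vf_apply (A j) iu x"
        by (intro vf_adjoint_mult smooth_intros) simp_all
      also have "vf_adjoint (A j) (\<lambda>x. (e * H j x) * (iu x * iu x)) x
        = (iu x * iu x) * vf_adjoint (A j) (\<lambda>x. e * H j x) x
          - (e * H j x) * vf_apply (A j) (\<lambda>x. iu x * iu x) x"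
        by (intro vf_adjoint_mult smooth_intros) simp_all
      also have "vf_apply (A j) (\<lambda>x. iu x * iu x) x = 2 * iu x * vf_apply (A j) iu x"
        by (subst vf_apply_mult) simp_all
      also have "vf_adjoint (A j) (\<lambda>x. e * H j x) x = e * vf_adjoint (A j) (H j) x"
      proof -
        have "vf_apply (A j) (\<lambda>x. e * H j x) x = e * vf_apply (A j) (H j) x"
          by (subst vf_apply_mult) (auto intro: smooth_intros simp: vf_apply_def)
        then show ?thesis by (simp add: vf_adjoint_eq smooth_intros algebra_simps)
      qed
      finally show ?thesis
        unfolding Xiu p_def by (simp add: power2_eq_square power4_eq_xxxx algebra_simps)
    qed
    then have "(\<Sum>j<m. vf_adjoint (A j) (p j) x - (p j x)\<^sup>2)
        = iu x * hoerm_lap A m u x + e * g x - e\<^sup>2 * b x"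
      unfolding hoerm_lap_def g_def b_def H(1)
      by (simp add: sum.distrib sum_subtractf sum_distrib_left)
    \<comment> \<open>The supersolution inequality divided by \<open>u\<close>.\<close>
    moreover have "V x \<le> iu x * hoerm_lap A m u x"
    proof -
      have "iu x * (V x * u x) \<le> iu x * hoerm_lap A m u x"
        using assms(5) iupos[of x] by (intro mult_left_mono) auto
      moreover have "iu x * (V x * u x) = V x" using un by (simp add: iu_def)
      ultimately show ?thesis by simp
    qed
    moreover have "c \<le> e * g x - e\<^sup>2 * b x"
    proof -
      have "e * b x \<le> e * (b x1 + 1)"
        using x1(2)[OF x] e by (intro mult_left_mono) auto
      also have "\<dots> = g x0 / 2" using b1 by (simp add: e_def field_simps)
      finally have "g x0 / 2 \<le> g x - e * b x" using x0(2)[OF x] by simp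
      then have "e * (g x0 / 2) \<le> e * (g x - e * b x)" using e by (intro mult_left_mono) auto
      then show ?thesis by (simp add: c_def power2_eq_square algebra_simps)
    qed
    ultimately show ?thesis by linarith
  qed
  \<comment> \<open>The normalisation of the competitors turns the Picone bound into the constant
    \<open>c\<close>, which is independent of \<open>f\<close>; hence the infimum itself is
    positive.\<close>
  have "ereal c \<le> lambda1 A m V D"
    unfolding lambda1_def
  proof (rule Inf_greatest, clarify)
    fix f assume f: "f \<in> C1_0 D" "integral D (\<lambda>x. (f x)\<^sup>2) = 1"
    have "c * integral D (\<lambda>x. (f x)\<^sup>2) \<le> integral D (\<lambda>x. grad_X_sq A m f x - V x * (f x)\<^sup>2)"
      by (rule energy_lower_bound[OF f(1) A sp assms(2)]) (use key closure_subset in blast)+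
    then show "ereal c \<le> ereal (integral D (\<lambda>x. grad_X_sq A m f x - V x * (f x)\<^sup>2))"
      using f(2) by simp
  qed
  then show ?thesis using c by (metis ereal_less(2) less_le_trans)
qed

end
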